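(* For every integer $n\ge 3$, $$\gamma_R(P_9\Box C_n)=\begin{cases}4n & \text{if } n\equiv 0 \pmod 5,\\ 4n+2 & \text{otherwise.}\end{cases}$$
   Context: A Roman dominating function of a graph $G$ is a function $f\colon V(G)\to\{0,1,2\}$ such that every vertex $v$ with $f(v)=0$ is adjacent to at least one vertex $w$ with $f(w)=2$. Its weight is $f(G)=\sum_{u\in V(G)}f(u)$, and the Roman domination number $\gamma_R(G)$ is the minimum weight of a Roman dominating function of $G$. $P_m$ is the path with $m$ vertices and $C_n$ is the cycle with $n$ vertices. The cylinder $P_m\Box C_n$ is their Cartesian product: vertex set $V(P_m)\times V(C_n)$, with $(u_1,v_1)$ and $(u_2,v_2)$ adjacent if and only if either $u_1=u_2$ and $v_1,v_2$ are adjacent in $C_n$, or $u_1,u_2$ are adjacent in $P_m$ and $v_1=v_2$. *)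

theory Defs
  imports "Graph_Theory.Pair_Digraph"
begin

text \<open>
  An undirected simple graph is a symmetric loop-free digraph without parallel arcs
  (locale \<^locale>\<open>pair_graph\<close>): an edge \<open>uv\<close> is the pair of arcs \<open>(u,v)\<close>, \<open>(v,u)\<close>.
\<close>

definition path_graph :: "nat \<Rightarrow> nat pair_pre_digraph" where
  "path_graph m =
    \<lparr> pverts = {0..<m},
      parcs = {(u, v). u < m \<and> v < m \<and> (v = Suc u \<or> u = Suc v)} \<rparr>"

text \<open>The following is a simple graph, and the cycle with \<open>n\<close> vertices, only for \<open>n \<ge> 3\<close>.\<close>

definition cycle_graph :: "nat \<Rightarrow> nat pair_pre_digraph" where
  "cycle_graph n =
    \<lparr> pverts = {0..<n},
      parcs = {(u, v). u < n \<and> v < n \<and> (v = Suc u mod n \<or> u = Suc v mod n)} \<rparr>"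

definition cartesian_product ::
  "'a pair_pre_digraph \<Rightarrow> 'b pair_pre_digraph \<Rightarrow> ('a \<times> 'b) pair_pre_digraph" (infixr \<open>\<box>\<close> 70) where
  "G \<box> H =
    \<lparr> pverts = pverts G \<times> pverts H,
      parcs = {((u\<^sub>1, v\<^sub>1), (u\<^sub>2, v\<^sub>2)).
        {u\<^sub>1, u\<^sub>2} \<subseteq> pverts G \<and> {v\<^sub>1, v\<^sub>2} \<subseteq> pverts H \<and>
        (u\<^sub>1 = u\<^sub>2 \<and> v\<^sub>1 \<rightarrow>\<^bsub>H\<^esub> v\<^sub>2 \<or> u\<^sub>1 \<rightarrow>\<^bsub>G\<^esub> u\<^sub>2 \<and> v\<^sub>1 = v\<^sub>2)} \<rparr>"

lemma pair_graph_path_graph: "pair_graph (path_graph m)"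
proof
  show "finite (pverts (path_graph m))"
    by (simp add: path_graph_def)
  show "finite (parcs (path_graph m))"
    by (rule finite_subset[of _ "{0..<m} \<times> {0..<m}"]) (auto simp: path_graph_def)
  show "symmetric (path_graph m)"
    by (auto simp: path_graph_def symmetric_def sym_def)
  fix e assume "e \<in> parcs (path_graph m)"
  then show "fst e \<in> pverts (path_graph m)" "snd e \<in> pverts (path_graph m)" "fst e \<noteq> snd e"
    by (auto simp: path_graph_def)
qed

lemma pair_graph_cycle_graph:
  assumes "3 \<le> n"
  shows "pair_graph (cycle_graph n)"
proof
  show "finite (pverts (cycle_graph n))"
    by (simp add: cycle_graph_def)
  show "finite (parcs (cycle_graph n))"
    by (rule finite_subset[of _ "{0..<n} \<times> {0..<n}"]) (auto simp: cycle_graph_def)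
  show "symmetric (cycle_graph n)"
    unfolding cycle_graph_def symmetric_def sym_def by simp blast
  fix e assume e: "e \<in> parcs (cycle_graph n)"
  then show "fst e \<in> pverts (cycle_graph n)" "snd e \<in> pverts (cycle_graph n)"
    by (simp_all add: cycle_graph_def case_prod_beta)
  have "u \<noteq> Suc u mod n" if "u < n" for u
    using that assms by (cases "Suc u = n") auto
  with e show "fst e \<noteq> snd e"
    unfolding cycle_graph_def by (cases e) (simp, metis)
qed

lemma pair_graph_cartesian_product:
  assumes "pair_graph G" "pair_graph H"
  shows "pair_graph (G \<box> H)"
proof -
  interpret G: pair_graph G by fact
  interpret H: pair_graph H by fact
  show ?thesis
  proof
    show "finite (pverts (G \<box> H))"
      by (simp add: cartesian_product_def G.pair_finite_verts H.pair_finite_verts)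
    show "finite (parcs (G \<box> H))"
      by (rule finite_subset[of _ "(pverts G \<times> pverts H) \<times> (pverts G \<times> pverts H)"])
        (auto simp: cartesian_product_def G.pair_finite_verts H.pair_finite_verts)
    show "symmetric (G \<box> H)"
      using G.pair_sym_arcs H.pair_sym_arcs
      unfolding cartesian_product_def symmetric_def sym_def by simp blast
    show "fst e \<in> pverts (G \<box> H)" "snd e \<in> pverts (G \<box> H)" if "e \<in> parcs (G \<box> H)" for e
      using that by (auto simp: cartesian_product_def)
    show "fst e \<noteq> snd e" if "e \<in> parcs (G \<box> H)" for e
      using that G.pair_no_loops[of "(u, v)" for u v] H.pair_no_loops[of "(u, v)" for u v]
      by (auto simp: cartesian_product_def)
  qed
qed

definition roman_dominating :: "'a pair_pre_digraph \<Rightarrow> ('a \<Rightarrow> nat) \<Rightarrow> bool" where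
  "roman_dominating G f \<longleftrightarrow>
    f ` pverts G \<subseteq> {0, 1, 2} \<and>
    (\<forall>v \<in> pverts G. f v = 0 \<longrightarrow> (\<exists>w \<in> pverts G. v \<rightarrow>\<^bsub>G\<^esub> w \<and> f w = 2))"

definition weight :: "'a pair_pre_digraph \<Rightarrow> ('a \<Rightarrow> nat) \<Rightarrow> nat" where
  "weight G f = (\<Sum>u \<in> pverts G. f u)"

definition roman_domination_number :: "'a pair_pre_digraph \<Rightarrow> nat" (\<open>\<gamma>\<^sub>R\<close>) where
  "\<gamma>\<^sub>R G = (LEAST k. \<exists>f. roman_dominating G f \<and> weight G f = k)"

lemma roman_domination_number_attained:
  "\<exists>f. roman_dominating G f \<and> weight G f = \<gamma>\<^sub>R G"
proof -
  have "roman_dominating G (\<lambda>_. 1)"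
    by (auto simp: roman_dominating_def)
  then have "\<exists>k f. roman_dominating G f \<and> weight G f = k"
    by blast
  then show ?thesis
    unfolding roman_domination_number_def by (rule LeastI_ex)
qed

end

theory Submission
  imports Defs
begin

text \<open>
  Lower bound: the weight is split between the top and the bottom half of the cylinder by prices on
  rows \<open>0..6\<close> such that the prices of a marking and of its mirror image add up to 20 times its weight.
  It then suffices to bound the total price of one strip from below by \<open>40 n\<close>, and by \<open>40 n + 11\<close> if
  \<open>5\<close> does not divide \<open>n\<close>: adding both halves gives \<open>20 w \<ge> 80 n + 22\<close>, hence \<open>w \<ge> 4 n + 2\<close>.
  Reading the strip column by column turns a Roman dominating function into a closed walk of
  length \<open>n\<close> on the \<open>3\<^sup>6\<close> possible states of the top six rows. A potential on the states
  makes all reduced prices (price minus 40 plus potential difference) nonnegative, and at least 4 on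
  every step that starts outside a small set of hubs. As \<open>n \<ge> 3\<close>, a closed walk of reduced
  price at most 10 visits a hub, and a shortest path computation on pairs (state, step number
  mod 5) shows that it can only return there after a multiple of 5 steps.

  Upper bound: five explicit cyclic words of columns, of lengths 4 to 8, which share their first and last
  columns with the word of length 5, so that copies of the latter can be appended; and a word of length 3.
\<close>

section \<open>The state graph of the top six rows\<close>

text \<open>
  The state of a cell that has been read together with the columns to its left: \<open>U\<close> is a 0 that still
  needs a 2 from the right, \<open>T\<close> is a 2, and \<open>I\<close> is everything else (a 1 or a dominated 0).
\<close>

datatype status = U | I | T

datatype label = V0 | V1 | V2

fun is_two :: "label \<Rightarrow> bool" where
  "is_two V0 = False" | "is_two V1 = False" | "is_two V2 = True"

text \<open>The arguments are: whether the entry above is a 2, the status of the left neighbour, the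
  entry itself, and the entry below. Among the left statuses only \<open>T\<close> can
  dominate.\<close>

fun new_status :: "bool \<Rightarrow> status \<Rightarrow> label \<Rightarrow> label \<Rightarrow> status" where
  "new_status up s V2 w = T"
| "new_status up s V1 w = I"
| "new_status True s V0 w = I"
| "new_status False T V0 w = I"
| "new_status False U V0 w = (if is_two w then I else U)"
| "new_status False I V0 w = (if is_two w then I else U)"

text \<open>Once the left, upper and lower neighbours have failed, a \<open>U\<close> cell can only
  be dominated from the right.\<close>

fun blocked :: "status \<Rightarrow> label \<Rightarrow> bool" where
  "blocked U v = (\<not> is_two v)" | "blocked I v = False" | "blocked T v = False"

text \<open>Columns have one entry more than there are statuses. The bottom entry serves to dominate
  the cell above it; its own domination is left open, so the walks relax the problem on the
  strip.\<close>

fun next_column :: "bool \<Rightarrow> status list \<Rightarrow> label list \<Rightarrow> status list" where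
  "next_column up (s # ss) (v # w # vs) = new_status up s v w # next_column (is_two v) ss (w # vs)"
| "next_column _ _ _ = []"

fun admissible :: "status list \<Rightarrow> label list \<Rightarrow> bool" where
  "admissible (s # ss) (v # vs) \<longleftrightarrow> \<not> blocked s v \<and> admissible ss vs"
| "admissible _ _ \<longleftrightarrow> True"

fun price :: "int \<times> int \<Rightarrow> label \<Rightarrow> int" where
  "price (x, y) V0 = 0" | "price (x, y) V1 = x" | "price (x, y) V2 = y"

fun cost :: "(int \<times> int) list \<Rightarrow> label list \<Rightarrow> int" where
  "cost (p # ps) (v # vs) = price p v + cost ps vs"
| "cost _ _ = 0"

section \<open>Tries of potentials and the pruned search for successor states\<close>

text \<open>
  A trie indexed by status lists; the number in an inner node bounds the leaves below it from below
  and serves to prune the search in \<open>extensions\<close>.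
\<close>

datatype pot = L int | N int pot pot pot

fun child :: "status \<Rightarrow> pot \<Rightarrow> pot \<Rightarrow> pot \<Rightarrow> pot" where
  "child U a b c = a" | "child I a b c = b" | "child T a b c = c"

fun lookup :: "pot \<Rightarrow> status list \<Rightarrow> int" where
  "lookup (N m a b c) (s # ss) = lookup (child s a b c) ss"
| "lookup (L d) _ = d"
| "lookup (N m a b c) [] = m"

fun root :: "pot \<Rightarrow> int" where
  "root (L d) = d" | "root (N m a b c) = m"

fun well_formed :: "nat \<Rightarrow> pot \<Rightarrow> bool" where
  "well_formed 0 (L d) \<longleftrightarrow> True"
| "well_formed (Suc n) (N m a b c) \<longleftrightarrow>
     m \<le> root a \<and> m \<le> root b \<and> m \<le> root c \<and> well_formed n a \<and> well_formed n b \<and> well_formed n c"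
| "well_formed _ _ \<longleftrightarrow> False"

lemma well_formed_child:
  "well_formed (Suc n) (N m a b c) \<Longrightarrow> well_formed n (child s a b c) \<and> m \<le> root (child s a b c)"
  by (cases s) auto

lemma root_le_lookup:
  "well_formed (length ss) t \<Longrightarrow> root t \<le> lookup t ss"
proof (induction ss arbitrary: t)
  case Nil
  then show ?case by (cases t) auto
next
  case (Cons s ss)
  then obtain m a b c where t: "t = N m a b c"
    by (cases t) auto
  then have "well_formed (length ss) (child s a b c)" "m \<le> root (child s a b c)"
    using Cons.prems well_formed_child by auto
  with Cons.IH[of "child s a b c"] t show ?case by simp
qed

fun prepend :: "'a \<Rightarrow> ('a list \<times> 'b) list \<Rightarrow> ('a list \<times> 'b) list" where
  "prepend x [] = []"
| "prepend x ((q, t) # qs) = (x # q, t) # prepend x qs"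

lemma set_prepend: "(y # q, t) \<in> set (prepend x qs) \<longleftrightarrow> y = x \<and> (q, t) \<in> set qs"
  by (induction x qs rule: prepend.induct) auto

text \<open>
  Enumerates the states reachable from \<open>ss\<close> by an admissible column, with price plus potential, as
  far as that is at most \<open>b\<close>. Here \<open>v\<close> is the entry of the column in the current row, \<open>c\<close> the price of
  the entries chosen so far (including \<open>v\<close>), and \<open>up\<close> tells whether the entry above \<open>v\<close> is a 2.
  This and the checks below are first-order and branch by \<open>if\<close> because the simplifier would otherwise
  evaluate under binders and both arguments of a conjunction.
\<close>

fun extensions ::
  "(int \<times> int) list \<Rightarrow> int \<Rightarrow> bool \<Rightarrow> status list \<Rightarrow> pot \<Rightarrow> label \<Rightarrow> int \<Rightarrow>
    (status list \<times> int) list" where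
  "extensions ps b up [] (L d) v c = (if c + d \<le> b then [([], c + d)] else [])"
| "extensions (p # ps) b up (s # ss) (N m t0 t1 t2) v c =
    (if b < c + m then [] else if blocked s v then [] else
      prepend (new_status up s v V0)
        (extensions ps b (is_two v) ss (child (new_status up s v V0) t0 t1 t2) V0 c) @
      prepend (new_status up s v V1)
        (extensions ps b (is_two v) ss (child (new_status up s v V1) t0 t1 t2) V1 (c + price p V1)) @
      prepend (new_status up s v V2)
        (extensions ps b (is_two v) ss (child (new_status up s v V2) t0 t1 t2) V2 (c + price p V2)))"
| "extensions _ _ _ _ _ _ _ = []"

lemma cost_nonneg: "\<forall>p \<in> set ps. 0 \<le> fst p \<and> 0 \<le> snd p \<Longrightarrow> 0 \<le> cost ps vs"
proof (induction ps vs rule: cost.induct)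
  case (1 p ps v vs)
  moreover have "0 \<le> price p v"
    using "1.prems" by (cases p; cases v) auto
  ultimately show ?case by simp
qed auto

lemma length_next_column: "length vs = Suc (length ss) \<Longrightarrow> length (next_column up ss vs) = length ss"
  by (induction up ss vs rule: next_column.induct) auto

text \<open>Pruning loses nothing: the entries still to come have nonnegative price and every leaf
  below is at least \<open>m\<close>, so \<open>b < c + m\<close> excludes all completions within
  the bound.\<close>

lemma extensions_complete:
  assumes "well_formed (length ss) t" "length vs = length ss" "length ps = length ss"
    and "\<forall>p \<in> set ps. 0 \<le> fst p \<and> 0 \<le> snd p" "admissible ss (v # vs)"
    and "c + cost ps vs + lookup t (next_column up ss (v # vs)) \<le> b"
  shows "(next_column up ss (v # vs), c + cost ps vs + lookup t (next_column up ss (v # vs)))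
    \<in> set (extensions ps b up ss t v c)"
  using assms
proof (induction ss arbitrary: t vs ps v c up)
  case Nil
  then show ?case by (cases t) auto
next
  case (Cons s ss)
  obtain w vs' where vs: "vs = w # vs'"
    using Cons.prems(2) by (cases vs) auto
  obtain p ps' where ps: "ps = p # ps'"
    using Cons.prems(3) by (cases ps) auto
  obtain m t0 t1 t2 where t: "t = N m t0 t1 t2"
    using Cons.prems(1) by (cases t) auto
  define x where "x = new_status up s v w"
  define u where "u = child x t0 t1 t2"
  define q where "q = next_column (is_two v) ss (w # vs')"
  have u: "well_formed (length ss) u" "m \<le> root u"
    using well_formed_child[of "length ss" m t0 t1 t2 x] Cons.prems(1) by (auto simp: t u_def)
  have q: "next_column up (s # ss) (v # vs) = x # q"
    by (simp add: vs x_def q_def)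
  have "length q = length ss"
    unfolding q_def using Cons.prems(2) by (intro length_next_column) (simp add: vs)
  then have "m \<le> lookup u q"
    using root_le_lookup[of q u] u by simp
  moreover have "0 \<le> cost ps vs"
    using Cons.prems(4) by (rule cost_nonneg)
  ultimately have "\<not> b < c + m"
    using Cons.prems(6) by (simp add: q t u_def)
  moreover have "\<not> blocked s v"
    using Cons.prems(5) by simp
  moreover have "(q, c + price p w + cost ps' vs' + lookup u q)
      \<in> set (extensions ps' b (is_two v) ss u w (c + price p w))"
    unfolding q_def
    by (rule Cons.IH) (use Cons.prems u in \<open>auto simp: vs ps t u_def x_def q_def add.assoc\<close>)
  ultimately show ?case
    unfolding q by (cases w; cases p) (auto simp: vs ps t u_def x_def set_prepend add.assoc)
qed

section \<open>Prices and verification of the potential\<close>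

text \<open>
  Give the rows \<open>-1, 0, 1, \<dots>\<close> the weights \<open>W = 4, 4, 4, 4, 3, 2, 1, 0, \<dots>\<close>, so that \<open>W i + W (8 - i) = 4\<close>
  on the cylinder. A 1 in row \<open>i\<close> costs \<open>5 W i\<close>, and a 2 costs \<open>2 (W (i - 1) + 3 W i + W (i + 1))\<close>,
  twice the weight of its closed neighbourhood.
\<close>

definition prices :: "(int \<times> int) list" where
  "prices = [(20, 40), (20, 40), (20, 38), (15, 30), (10, 20), (5, 10), (0, 2)]"

text \<open>One search for each entry of the top row, whose price 0, 20 or 40 is paid in advance;
  hence the tail of \<open>prices\<close>. No row lies above, hence \<open>False\<close>.\<close>

definition successors :: "pot \<Rightarrow> int \<Rightarrow> status list \<Rightarrow> (status list \<times> int) list" where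
  "successors t b ss =
    extensions (tl prices) b False ss t V0 0 @
    extensions (tl prices) b False ss t V1 20 @
    extensions (tl prices) b False ss t V2 40"

lemma successors_complete:
  assumes "well_formed 6 t" "length ss = 6" "length vs = 7" "admissible ss vs"
    and "cost prices vs + lookup t (next_column False ss vs) \<le> b"
  shows "(next_column False ss vs, cost prices vs + lookup t (next_column False ss vs))
    \<in> set (successors t b ss)"
proof -
  obtain v ws where vs: "vs = v # ws"
    using assms(3) by (cases vs) auto
  have "(next_column False ss vs, price (20, 40) v + cost (tl prices) ws + lookup t (next_column False ss vs))
    \<in> set (extensions (tl prices) b False ss t v (price (20, 40) v))"
    unfolding vs
    by (rule extensions_complete) (use assms in \<open>auto simp: vs prices_def\<close>)
  then show ?thesis
    by (cases v) (auto simp: vs successors_def prices_def)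
qed

text \<open>Every column from \<open>ss\<close> to \<open>q\<close> must satisfy
  \<open>price - 40 + potential q - potential ss \<ge> (if ss \<in> H then 0 else 4)\<close>.\<close>

fun check_potential :: "pot \<Rightarrow> status list set \<Rightarrow> pot \<Rightarrow> status list \<Rightarrow> bool" where
  "check_potential t H (L d) rs \<longleftrightarrow>
    (case successors t (if rev rs \<in> H then d + 39 else d + 43) (rev rs) of [] \<Rightarrow> True | _ \<Rightarrow> False)"
| "check_potential t H (N m a b c) rs \<longleftrightarrow>
    (if check_potential t H a (U # rs) then
      if check_potential t H b (I # rs) then check_potential t H c (T # rs) else False
     else False)"

text \<open>\<open>rs\<close> is the branch taken so far, read backwards, so at a leaf
  \<open>rev rs\<close> is the full state. Prices being integers, 39 and 43 stand for reduced price
  below 0 and below 4.\<close>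

lemma check_potential_sound:
  assumes "check_potential t H u rs" "well_formed (length ss) u"
  shows "successors t (if rev rs @ ss \<in> H then lookup u ss + 39 else lookup u ss + 43) (rev rs @ ss) = []"
  using assms
proof (induction ss arbitrary: u rs)
  case Nil
  then show ?case by (cases u) (auto split: list.splits)
next
  case (Cons s ss)
  then obtain m a b c where u: "u = N m a b c"
    by (cases u) auto
  then have "check_potential t H (child s a b c) (s # rs)"
    using Cons.prems by (cases s) (auto split: if_splits)
  moreover have "well_formed (length ss) (child s a b c)"
    using well_formed_child[of "length ss" m a b c s] Cons.prems(2) u by simp
  ultimately show ?case
    using Cons.IH[of "child s a b c" "s # rs"] by (auto simp: u split: if_splits)
qed

section \<open>Distance tables modulo 5\<close>

text \<open>The shortest path inequality for a step of reduced price \<open>r\<close>, waived at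
  residues where the step would exceed the budget of 10.\<close>

fun dominates :: "int \<Rightarrow> int list \<Rightarrow> int list \<Rightarrow> bool" where
  "dominates r (x # xs) (y # ys) \<longleftrightarrow>
    (if 10 < x + r then dominates r xs ys else if y \<le> x + r then dominates r xs ys else False)"
| "dominates r [] [] \<longleftrightarrow> True"
| "dominates r _ _ \<longleftrightarrow> False"

lemma dominates_length: "dominates r xs ys \<Longrightarrow> length xs = length ys"
  by (induction r xs ys rule: dominates.induct) (auto split: if_splits)

lemma dominates_nth:
  "dominates r xs ys \<Longrightarrow> i < length xs \<Longrightarrow> xs ! i + r \<le> 10 \<Longrightarrow> ys ! i \<le> xs ! i + r"
  by (induction r xs ys arbitrary: i rule: dominates.induct)
     (auto simp: nth_Cons split: nat.splits if_splits)

text \<open>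
  A table assigns to a state five numbers, one for each residue \<open>p\<close> modulo 5: a lower bound on the reduced
  price of a walk from a start state that arrives with step number \<open>p\<close>, where 11 means that this is
  impossible within the budget of 10.
\<close>

fun check_moves ::
  "(status list \<times> int list) list \<Rightarrow> int \<Rightarrow> int list \<Rightarrow> (status list \<times> int) list \<Rightarrow> bool" where
  "check_moves tab d us [] \<longleftrightarrow> True"
| "check_moves tab d us ((q, t) # qs) \<longleftrightarrow>
    (case map_of tab q of
      None \<Rightarrow> False
    | Some ws \<Rightarrow> if dominates (t - d) us (rotate1 ws) then check_moves tab d us qs else False)"

lemma check_moves_sound:
  "check_moves tab d us qs \<Longrightarrow> (q, t) \<in> set qs \<Longrightarrow>
    \<exists>ws. map_of tab q = Some ws \<and> dominates (t - d) us (rotate1 ws)"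
  by (induction qs) (auto split: option.splits if_splits)

text \<open>The search bound amounts to: reduced price plus smallest label at most 10. A dearer move
  breaks the budget for every residue, so nothing needs checking there.\<close>

fun check_labels ::
  "pot \<Rightarrow> (status list \<times> int list) list \<Rightarrow> (status list \<times> int list) list \<Rightarrow> bool" where
  "check_labels t tab [] \<longleftrightarrow> True"
| "check_labels t tab ((s, us) # rows) \<longleftrightarrow>
    (if check_moves tab (lookup t s + 40) us (successors t (lookup t s + 50 - foldr min us 11) s)
     then check_labels t tab rows else False)"

lemma check_labels_sound:
  "check_labels t tab rows \<Longrightarrow> (s, us) \<in> set rows \<Longrightarrow>
    check_moves tab (lookup t s + 40) us (successors t (lookup t s + 50 - foldr min us 11) s)"
  by (induction rows) (auto split: if_splits)

lemma foldr_min_le: "(x :: int) \<in> set xs \<Longrightarrow> foldr min xs a \<le> x"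
  by (induction xs) auto

text \<open>Labels of a start state: being there is free at one residue and impossible at the other
  four. Several start states may share a table, with different residues.\<close>

definition unit_labels :: "int list list" where
  "unit_labels =
    [[0,11,11,11,11], [11,0,11,11,11], [11,11,0,11,11], [11,11,11,0,11], [11,11,11,11,0]]"

lemma unit_labels_eq: "unit_labels = map (\<lambda>p. (replicate 5 11)[p := 0]) [0..<5]"
  by (simp add: unit_labels_def upt_rec numeral_eq_Suc)

lemma unit_labels_nth:
  assumes "us \<in> set unit_labels"
  shows "\<exists>p < 5. length us = 5 \<and> us ! p = 0 \<and> (\<forall>i < 5. us ! i \<le> 10 \<longrightarrow> i = p)"
proof -
  obtain p where "p \<in> set [0..<5]" and us: "us = (replicate 5 11)[p := 0]"
    using assms unfolding unit_labels_eq set_map by blast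
  then have p: "p < 5" by simp
  have nth: "us ! i = (if i = p then 0 else 11)" if "i < 5" for i
    using that by (simp add: us nth_list_update)
  moreover have "length us = 5"
    by (simp add: us)
  ultimately show ?thesis
    using p by (intro exI[of _ p]) (simp add: nth)
qed

fun is_start :: "int list option \<Rightarrow> bool" where
  "is_start None \<longleftrightarrow> False"
| "is_start (Some us) \<longleftrightarrow> us \<in> set unit_labels"

fun starts_somewhere :: "(status list \<times> int list) list list \<Rightarrow> status list \<Rightarrow> bool" where
  "starts_somewhere [] h \<longleftrightarrow> False"
| "starts_somewhere (tab # tabs) h \<longleftrightarrow> (if is_start (map_of tab h) then True else starts_somewhere tabs h)"

lemma starts_somewhere_iff:
  "starts_somewhere tabs h \<longleftrightarrow> (\<exists>tab \<in> set tabs. \<exists>us \<in> set unit_labels. map_of tab h = Some us)"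
  by (induction tabs) (auto split: if_splits elim: is_start.elims)

fun check_hubs :: "(status list \<times> int list) list list \<Rightarrow> status list list \<Rightarrow> bool" where
  "check_hubs tabs [] \<longleftrightarrow> True"
| "check_hubs tabs (h # hs) \<longleftrightarrow> (if starts_somewhere tabs h then check_hubs tabs hs else False)"

lemma check_hubs_sound: "check_hubs tabs hs \<Longrightarrow> h \<in> set hs \<Longrightarrow> starts_somewhere tabs h"
  by (induction hs) (auto split: if_splits)

section \<open>The certificate\<close>

text \<open>
  Shortest path distances to the states on the optimal cycles, where steps from outside the hubs are made
  cheaper by 4, shifted to be nonnegative.
\<close>

definition potential :: pot where
  "potential =
  N 0 (N 28 (N 54 (N 82 (N 110 (N 124 (L 134) (L 124) (L 124)) (N 110 (L 118) (L 112) (L 110)) (N 110 (L 118)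
  (L 112) (L 110))) (N 82 (N 96 (L 104) (L 96) (L 96)) (N 88 (L 92) (L 90) (L 88)) (N 82 (L 92) (L 82) (L
  82))) (N 82 (N 96 (L 104) (L 96) (L 96)) (N 88 (L 92) (L 90) (L 88)) (N 82 (L 92) (L 82) (L 82)))) (N 54 (N
  74 (N 86 (L 96) (L 86) (L 86)) (N 74 (L 80) (L 74) (L 76)) (N 74 (L 80) (L 74) (L 76))) (N 64 (N 70 (L 78)
  (L 70) (L 70)) (N 69 (L 72) (L 70) (L 69)) (N 64 (L 72) (L 66) (L 64))) (N 54 (N 70 (L 78) (L 70) (L 70)) (N
  54 (L 64) (L 56) (L 54)) (N 54 (L 64) (L 56) (L 54)))) (N 54 (N 74 (N 86 (L 96) (L 86) (L 86)) (N 74 (L 80)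
  (L 74) (L 76)) (N 74 (L 80) (L 74) (L 76))) (N 64 (N 70 (L 78) (L 70) (L 70)) (N 69 (L 72) (L 70) (L 69)) (N
  64 (L 72) (L 66) (L 64))) (N 54 (N 70 (L 78) (L 70) (L 70)) (N 54 (L 64) (L 56) (L 54)) (N 54 (L 64) (L 56)
  (L 54))))) (N 28 (N 56 (N 71 (N 84 (L 94) (L 84) (L 84)) (N 71 (L 79) (L 76) (L 71)) (N 71 (L 79) (L 72) (L
  71))) (N 56 (N 68 (L 76) (L 68) (L 68)) (N 60 (L 64) (L 60) (L 60)) (N 56 (L 64) (L 62) (L 56))) (N 56 (N 68
  (L 76) (L 68) (L 68)) (N 60 (L 64) (L 60) (L 60)) (N 56 (L 64) (L 58) (L 56)))) (N 38 (N 56 (N 66 (L 74) (L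
  66) (L 66)) (N 56 (L 60) (L 56) (L 56)) (N 56 (L 60) (L 56) (L 56))) (N 48 (N 50 (L 60) (L 50) (L 50)) (N 50
  (L 57) (L 50) (L 50)) (N 48 (L 57) (L 50) (L 48))) (N 38 (N 50 (L 60) (L 50) (L 50)) (N 50 (L 54) (L 52) (L
  50)) (N 38 (L 50) (L 40) (L 38)))) (N 28 (N 56 (N 66 (L 74) (L 66) (L 66)) (N 56 (L 60) (L 56) (L 56)) (N 56
  (L 60) (L 56) (L 56))) (N 32 (N 48 (L 56) (L 48) (L 48)) (N 40 (L 44) (L 44) (L 40)) (N 32 (L 40) (L 34) (L
  32))) (N 28 (N 48 (L 56) (L 48) (L 48)) (N 28 (L 36) (L 30) (L 28)) (N 28 (L 36) (L 30) (L 28))))) (N 28 (N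
  56 (N 71 (N 84 (L 94) (L 84) (L 84)) (N 71 (L 79) (L 72) (L 71)) (N 71 (L 79) (L 72) (L 71))) (N 56 (N 68 (L
  76) (L 68) (L 68)) (N 60 (L 64) (L 60) (L 60)) (N 56 (L 64) (L 58) (L 56))) (N 56 (N 68 (L 76) (L 68) (L
  68)) (N 60 (L 64) (L 60) (L 60)) (N 56 (L 64) (L 58) (L 56)))) (N 38 (N 56 (N 66 (L 74) (L 66) (L 66)) (N 56
  (L 60) (L 56) (L 56)) (N 56 (L 60) (L 56) (L 56))) (N 48 (N 50 (L 60) (L 50) (L 50)) (N 50 (L 57) (L 50) (L
  50)) (N 48 (L 57) (L 50) (L 48))) (N 38 (N 50 (L 60) (L 50) (L 50)) (N 46 (L 50) (L 48) (L 46)) (N 38 (L 50)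
  (L 40) (L 38)))) (N 28 (N 56 (N 66 (L 74) (L 66) (L 66)) (N 56 (L 60) (L 56) (L 56)) (N 56 (L 60) (L 56) (L
  56))) (N 32 (N 48 (L 56) (L 48) (L 48)) (N 40 (L 40) (L 40) (L 40)) (N 32 (L 40) (L 34) (L 32))) (N 28 (N 48
  (L 56) (L 48) (L 48)) (N 28 (L 36) (L 30) (L 28)) (N 28 (L 36) (L 30) (L 28)))))) (N 6 (N 33 (N 56 (N 72 (N
  92 (L 100) (L 92) (L 92)) (N 72 (L 80) (L 74) (L 72)) (N 72 (L 80) (L 74) (L 72))) (N 56 (N 68 (L 76) (L 68)
  (L 68)) (N 60 (L 65) (L 62) (L 60)) (N 56 (L 65) (L 56) (L 56))) (N 56 (N 68 (L 76) (L 68) (L 68)) (N 60 (L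
  65) (L 62) (L 60)) (N 56 (L 65) (L 56) (L 56)))) (N 33 (N 52 (N 64 (L 72) (L 64) (L 64)) (N 56 (L 60) (L 56)
  (L 56)) (N 52 (L 60) (L 52) (L 52))) (N 40 (N 49 (L 57) (L 49) (L 49)) (N 42 (L 44) (L 44) (L 42)) (N 40 (L
  44) (L 46) (L 40))) (N 33 (N 49 (L 57) (L 49) (L 49)) (N 38 (L 47) (L 44) (L 38)) (N 33 (L 43) (L 39) (L
  33)))) (N 33 (N 52 (N 64 (L 72) (L 64) (L 64)) (N 52 (L 60) (L 52) (L 52)) (N 52 (L 60) (L 52) (L 52))) (N
  40 (N 49 (L 57) (L 49) (L 49)) (N 42 (L 44) (L 44) (L 42)) (N 40 (L 44) (L 42) (L 40))) (N 33 (N 49 (L 57)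
  (L 49) (L 49)) (N 38 (L 43) (L 40) (L 38)) (N 33 (L 43) (L 35) (L 33))))) (N 20 (N 38 (N 54 (N 74 (L 82) (L
  74) (L 74)) (N 54 (L 62) (L 56) (L 54)) (N 54 (L 62) (L 56) (L 54))) (N 38 (N 48 (L 56) (L 48) (L 48)) (N 42
  (L 44) (L 44) (L 42)) (N 38 (L 44) (L 42) (L 38))) (N 38 (N 48 (L 56) (L 48) (L 48)) (N 42 (L 44) (L 44) (L
  42)) (N 38 (L 44) (L 38) (L 38)))) (N 33 (N 42 (N 62 (L 69) (L 62) (L 62)) (N 42 (L 50) (L 44) (L 42)) (N 42
  (L 50) (L 44) (L 42))) (N 38 (N 48 (L 56) (L 48) (L 48)) (N 42 (L 44) (L 44) (L 42)) (N 38 (L 44) (L 38) (L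
  38))) (N 33 (N 48 (L 56) (L 48) (L 48)) (N 38 (L 43) (L 40) (L 38)) (N 33 (L 43) (L 35) (L 33)))) (N 20 (N
  42 (N 62 (L 69) (L 62) (L 62)) (N 42 (L 50) (L 44) (L 42)) (N 42 (L 50) (L 44) (L 42))) (N 30 (N 42 (L 50)
  (L 46) (L 42)) (N 40 (L 40) (L 40) (L 40)) (N 30 (L 40) (L 32) (L 30))) (N 20 (N 42 (L 46) (L 42) (L 42)) (N
  25 (L 28) (L 27) (L 25)) (N 20 (L 28) (L 20) (L 20))))) (N 6 (N 38 (N 54 (N 74 (L 82) (L 74) (L 74)) (N 54
  (L 62) (L 56) (L 54)) (N 54 (L 62) (L 56) (L 54))) (N 38 (N 48 (L 56) (L 48) (L 48)) (N 42 (L 44) (L 44) (L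
  42)) (N 38 (L 44) (L 38) (L 38))) (N 38 (N 48 (L 56) (L 48) (L 48)) (N 42 (L 44) (L 44) (L 42)) (N 38 (L 44)
  (L 38) (L 38)))) (N 16 (N 38 (N 46 (L 54) (L 46) (L 46)) (N 38 (L 46) (L 44) (L 38)) (N 38 (L 46) (L 40) (L
  38))) (N 31 (N 38 (L 46) (L 42) (L 38)) (N 37 (L 41) (L 37) (L 37)) (N 31 (L 37) (L 33) (L 31))) (N 16 (N 38
  (L 42) (L 38) (L 38)) (N 24 (L 26) (L 26) (L 24)) (N 16 (L 26) (L 18) (L 16)))) (N 6 (N 38 (N 46 (L 54) (L
  46) (L 46)) (N 38 (L 46) (L 40) (L 38)) (N 38 (L 46) (L 40) (L 38))) (N 12 (N 26 (L 34) (L 26) (L 26)) (N 21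
  (L 22) (L 22) (L 21)) (N 12 (L 22) (L 14) (L 12))) (N 6 (N 26 (L 34) (L 26) (L 26)) (N 6 (L 16) (L 8) (L 6))
  (N 6 (L 16) (L 8) (L 6)))))) (N 0 (N 33 (N 56 (N 72 (N 92 (L 100) (L 92) (L 92)) (N 72 (L 80) (L 74) (L 72))
  (N 72 (L 80) (L 74) (L 72))) (N 56 (N 68 (L 76) (L 68) (L 68)) (N 60 (L 65) (L 62) (L 60)) (N 56 (L 65) (L
  56) (L 56))) (N 56 (N 68 (L 76) (L 68) (L 68)) (N 60 (L 65) (L 62) (L 60)) (N 56 (L 65) (L 56) (L 56)))) (N
  33 (N 52 (N 64 (L 72) (L 64) (L 64)) (N 52 (L 60) (L 52) (L 52)) (N 52 (L 60) (L 52) (L 52))) (N 40 (N 49 (L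
  57) (L 49) (L 49)) (N 42 (L 44) (L 44) (L 42)) (N 40 (L 44) (L 42) (L 40))) (N 33 (N 49 (L 57) (L 49) (L
  49)) (N 38 (L 43) (L 40) (L 38)) (N 33 (L 43) (L 35) (L 33)))) (N 33 (N 52 (N 64 (L 72) (L 64) (L 64)) (N 52
  (L 60) (L 52) (L 52)) (N 52 (L 60) (L 52) (L 52))) (N 40 (N 49 (L 57) (L 49) (L 49)) (N 42 (L 44) (L 44) (L
  42)) (N 40 (L 44) (L 42) (L 40))) (N 33 (N 49 (L 57) (L 49) (L 49)) (N 38 (L 43) (L 40) (L 38)) (N 33 (L 43)
  (L 35) (L 33))))) (N 0 (N 34 (N 51 (N 64 (L 74) (L 64) (L 64)) (N 51 (L 59) (L 52) (L 51)) (N 51 (L 59) (L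
  52) (L 51))) (N 34 (N 46 (L 54) (L 50) (L 46)) (N 42 (L 44) (L 42) (L 44)) (N 34 (L 44) (L 34) (L 34))) (N
  34 (N 46 (L 54) (L 46) (L 46)) (N 40 (L 44) (L 42) (L 40)) (N 34 (L 44) (L 34) (L 34)))) (N 18 (N 30 (N 45
  (L 49) (L 45) (L 45)) (N 34 (L 38) (L 36) (L 34)) (N 30 (L 34) (L 32) (L 30))) (N 30 (N 32 (L 42) (L 32) (L
  32)) (N 30 (L 34) (L 32) (L 30)) (N 30 (L 34) (L 32) (L 30))) (N 18 (N 32 (L 42) (L 32) (L 32)) (N 24 (L 30)
  (L 30) (L 24)) (N 18 (L 26) (L 20) (L 18)))) (N 0 (N 30 (N 45 (L 49) (L 45) (L 45)) (N 30 (L 34) (L 32) (L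
  30)) (N 30 (L 34) (L 32) (L 30))) (N 12 (N 22 (L 26) (L 26) (L 22)) (N 20 (L 26) (L 22) (L 20)) (N 12 (L 22)
  (L 14) (L 12))) (N 0 (N 22 (L 26) (L 22) (L 22)) (N 5 (L 8) (L 7) (L 5)) (N 0 (L 8) (L 0) (L 0))))) (N 0 (N
  34 (N 51 (N 64 (L 74) (L 64) (L 64)) (N 51 (L 59) (L 52) (L 51)) (N 51 (L 59) (L 52) (L 51))) (N 34 (N 46 (L
  54) (L 46) (L 46)) (N 40 (L 44) (L 42) (L 40)) (N 34 (L 44) (L 34) (L 34))) (N 34 (N 46 (L 54) (L 46) (L
  46)) (N 40 (L 44) (L 42) (L 40)) (N 34 (L 44) (L 34) (L 34)))) (N 0 (N 26 (N 41 (L 49) (L 41) (L 41)) (N 26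
  (L 34) (L 28) (L 26)) (N 26 (L 34) (L 28) (L 26))) (N 12 (N 18 (L 24) (L 18) (L 18)) (N 18 (L 20) (L 18) (L
  18)) (N 12 (L 20) (L 14) (L 12))) (N 0 (N 18 (L 24) (L 18) (L 18)) (N 4 (L 8) (L 10) (L 4)) (N 0 (L 8) (L 0)
  (L 0)))) (N 0 (N 26 (N 41 (L 49) (L 41) (L 41)) (N 26 (L 34) (L 28) (L 26)) (N 26 (L 34) (L 28) (L 26))) (N
  0 (N 14 (L 24) (L 14) (L 14)) (N 8 (L 8) (L 8) (L 8)) (N 0 (L 8) (L 2) (L 0))) (N 0 (N 14 (L 24) (L 14) (L
  14)) (N 4 (L 8) (L 6) (L 4)) (N 0 (L 8) (L 0) (L 0))))))"

definition hubs :: "status list list" where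
  "hubs =
  [[U,I,U,U,I,I], [U,I,U,I,T,I], [U,I,I,T,I,U], [U,I,I,T,I,I], [U,I,I,T,I,T], [U,I,T,I,I,U], [U,I,T,I,I,I],
  [I,U,I,U,I,I], [I,U,I,U,I,T], [I,U,I,I,T,I], [I,U,I,T,I,U], [I,U,I,T,I,I], [I,U,I,T,T,I], [I,I,U,I,T,I],
  [I,I,T,I,U,U], [I,I,T,I,U,I], [I,T,I,U,I,I], [I,T,I,I,U,U], [I,T,I,I,U,I], [I,T,I,I,I,U], [T,I,U,I,U,I],
  [T,I,U,I,I,T], [T,I,I,U,I,U], [T,I,I,U,I,I], [T,I,I,U,I,T], [T,I,I,T,I,U], [T,I,I,T,I,I], [T,I,T,I,U,I],
  [T,I,T,I,I,U], [T,T,I,T,I,I]]"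

text \<open>
  One table does not suffice: some hubs are joined, within the budget, by walks whose lengths do not fit
  together modulo 5. Each table starts from hubs for which they do.
\<close>

definition labelsA :: "(status list \<times> int list) list" where
  "labelsA =
  [([U,U,I,I,T,I],[11,11,11,0,11]), ([U,I,U,U,I,I],[0,11,11,11,11]), ([U,I,U,I,T,T],[11,0,11,11,11]),
  ([U,I,I,T,I,U],[0,11,11,11,11]), ([U,I,I,T,I,I],[0,11,11,11,11]), ([U,I,I,T,I,T],[0,11,11,11,11]),
  ([I,U,I,I,T,I],[11,11,11,0,11]), ([I,U,I,I,T,T],[11,11,11,0,11]), ([I,I,U,I,U,I],[11,0,10,11,11]),
  ([I,I,T,I,U,U],[11,11,0,11,11]), ([I,I,T,I,U,I],[11,11,0,11,11]), ([I,I,T,I,T,I],[11,11,0,11,11]),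
  ([I,T,I,U,I,U],[11,11,11,11,0]), ([I,T,I,U,I,I],[11,11,11,11,0]), ([I,T,I,I,U,U],[0,11,11,11,11]),
  ([T,I,U,I,U,I],[11,0,11,11,11]), ([T,I,U,I,I,T],[11,0,11,11,11]), ([T,I,T,I,U,I],[11,11,0,11,11]),
  ([T,I,T,T,I,U],[11,0,11,11,11]), ([T,T,I,T,I,I],[0,11,11,11,11]), ([T,I,T,T,I,I],[11,1,11,11,11]),
  ([I,I,U,I,I,T],[11,2,10,11,11]), ([I,I,U,I,T,T],[11,2,11,11,11]), ([I,T,I,U,I,T],[11,11,11,10,2]),
  ([T,I,U,I,U,U],[11,2,11,11,11]), ([T,I,U,I,I,U],[11,2,11,11,11]), ([T,I,U,I,I,I],[11,2,11,11,11]),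
  ([T,I,U,I,T,I],[11,2,11,11,8]), ([T,I,I,I,U,I],[11,2,11,11,11]), ([U,U,I,U,I,I],[11,11,11,4,11]),
  ([U,U,I,I,T,T],[11,11,11,4,11]), ([U,I,I,I,T,I],[11,11,11,4,11]), ([U,I,T,I,T,I],[11,11,4,6,11]),
  ([I,U,I,I,I,T],[11,11,4,9,11]), ([I,I,U,I,I,U],[11,4,11,11,11]), ([I,I,T,I,I,I],[11,11,4,11,11]),
  ([I,I,T,I,I,T],[11,11,4,11,11]), ([T,I,T,I,I,I],[10,11,4,10,11]), ([T,T,I,U,I,I],[11,11,11,11,4]),
  ([I,U,I,I,U,I],[11,11,5,8,11]), ([U,I,U,I,T,I],[11,6,10,11,10]), ([U,I,I,U,I,I],[11,11,11,6,11]),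
  ([U,I,I,T,T,I],[6,11,11,11,11]), ([U,I,T,I,U,I],[11,11,6,10,11]), ([U,I,T,I,I,U],[10,11,6,10,11]),
  ([U,I,T,I,I,I],[11,11,6,11,11]), ([I,U,U,I,T,I],[11,11,6,11,10]), ([I,U,I,U,I,I],[11,11,11,6,11]),
  ([I,U,I,T,I,I],[10,11,10,11,6]), ([I,U,I,T,I,T],[10,11,11,11,6]), ([I,I,U,I,U,U],[11,6,11,11,11]),
  ([I,I,U,I,I,I],[11,6,11,11,11]), ([I,I,U,I,T,I],[11,6,10,11,10]), ([I,I,T,I,I,U],[11,11,6,11,11]),
  ([I,I,T,I,T,T],[11,11,6,11,11]), ([I,T,I,I,U,I],[6,10,11,10,11]), ([I,T,I,T,I,U],[11,11,11,11,6]),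
  ([T,I,I,U,I,U],[11,11,11,6,10]), ([T,I,I,U,I,I],[11,11,11,6,10]), ([T,I,I,U,I,T],[11,10,11,6,10]),
  ([T,I,I,I,I,T],[11,6,11,11,11]), ([T,I,I,I,T,I],[11,11,11,6,11]), ([I,U,I,I,I,U],[11,11,8,7,11]),
  ([I,U,I,T,I,U],[11,11,11,11,7]), ([I,T,I,I,I,T],[7,11,11,11,11]), ([I,T,I,I,T,I],[11,11,11,7,7]),
  ([T,I,T,T,I,T],[11,7,11,11,11]), ([U,U,I,U,I,U],[11,11,11,8,11]), ([U,I,I,U,I,U],[11,11,11,8,11]),
  ([U,I,I,I,T,T],[11,11,11,8,11]), ([U,I,T,I,I,T],[11,11,8,11,11]), ([I,U,U,I,I,T],[10,11,8,11,11]),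
  ([I,U,I,U,U,I],[11,11,11,8,11]), ([I,U,I,U,I,U],[11,11,11,8,11]), ([I,U,I,U,I,T],[11,11,11,8,11]),
  ([I,I,I,T,I,I],[8,11,11,11,11]), ([I,T,I,U,U,I],[11,11,11,8,11]), ([I,T,I,I,I,I],[11,11,11,11,8]),
  ([I,T,I,T,I,I],[11,11,11,11,8]), ([T,I,U,U,I,I],[11,11,11,11,8]), ([T,I,I,T,I,U],[11,8,11,11,10]),
  ([T,I,T,I,I,U],[11,11,8,11,11]), ([T,T,I,U,I,U],[11,11,11,11,8]), ([T,T,I,I,U,I],[11,8,11,11,11]),
  ([T,T,I,I,T,I],[11,11,11,11,8]), ([T,T,I,T,I,U],[11,11,11,11,8]), ([U,U,I,I,U,I],[11,11,11,9,11]),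
  ([U,I,I,I,U,I],[11,11,11,9,11]), ([I,U,I,I,I,I],[11,11,10,9,11]), ([I,I,I,T,I,U],[9,11,11,11,11]),
  ([T,I,I,U,U,I],[11,11,11,9,11]), ([T,T,I,I,I,U],[11,11,11,11,9]), ([T,T,I,I,I,I],[11,11,11,11,9]),
  ([U,U,I,U,U,I],[11,11,11,10,11]), ([U,U,I,U,I,T],[11,11,11,10,11]), ([U,U,I,T,I,I],[11,11,11,10,11]),
  ([U,I,U,U,I,T],[10,11,11,11,11]), ([U,I,U,I,I,T],[10,11,11,11,11]), ([U,I,I,U,U,I],[11,11,11,10,11]),
  ([U,I,I,U,I,T],[11,11,11,10,11]), ([U,I,T,I,T,T],[11,11,10,10,11]), ([I,U,U,U,I,I],[11,11,11,11,10]),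
  ([I,U,U,I,U,I],[11,11,10,11,11]), ([I,T,I,I,I,U],[11,11,11,11,10]), ([I,T,T,I,I,U],[11,11,11,10,11]),
  ([T,I,U,I,T,T],[11,10,11,11,11]), ([T,I,I,I,U,U],[11,10,11,11,11]), ([T,I,I,I,T,T],[11,11,11,10,11]),
  ([T,I,I,T,I,I],[11,10,11,11,11]), ([T,I,I,T,I,T],[11,10,11,11,11]), ([T,T,I,U,I,T],[11,11,11,11,10])]"

definition labelsB :: "(status list \<times> int list) list" where
  "labelsB =
  [([U,I,U,U,I,T],[11,11,11,11,0]), ([U,I,U,I,T,I],[11,11,11,11,0]), ([U,I,T,I,I,U],[0,11,11,11,11]),
  ([U,I,T,I,I,I],[0,11,11,11,11]), ([I,U,U,I,I,T],[11,0,11,11,11]), ([I,U,I,U,I,I],[11,0,11,11,11]),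
  ([I,U,I,U,I,T],[11,0,11,11,11]), ([I,U,I,T,I,U],[11,11,0,11,11]), ([I,U,I,T,I,I],[11,11,0,11,11]),
  ([I,U,I,T,I,T],[11,8,0,11,11]), ([I,U,I,T,T,I],[11,11,0,11,11]), ([I,I,U,I,T,I],[11,11,11,11,0]),
  ([I,T,I,I,U,I],[11,11,11,0,11]), ([I,T,I,I,I,U],[11,11,11,0,11]), ([I,T,I,I,I,I],[11,11,11,0,11]),
  ([I,T,I,I,I,T],[11,11,11,0,11]), ([I,T,I,T,I,U],[11,11,0,11,11]), ([I,T,I,T,I,I],[11,11,0,11,11]),
  ([T,I,I,U,I,U],[11,0,11,11,11]), ([T,I,I,U,I,I],[11,0,11,11,11]), ([T,I,I,U,I,T],[11,0,11,11,11]),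
  ([T,I,I,T,I,U],[0,11,11,11,11]), ([T,I,T,I,I,U],[0,11,11,11,11]), ([T,I,T,I,I,I],[0,11,11,11,11]),
  ([I,U,I,I,I,T],[11,1,11,11,11]), ([U,I,U,I,T,T],[11,11,11,11,2]), ([I,I,U,I,I,T],[11,2,11,6,6]),
  ([I,T,I,I,U,U],[11,11,11,2,11]), ([I,I,U,U,I,T],[11,11,11,11,3]), ([T,I,I,U,U,I],[11,3,11,11,11]),
  ([U,U,I,I,T,I],[8,4,7,11,11]), ([U,I,U,I,U,I],[11,11,11,4,6]), ([U,I,U,I,I,T],[11,11,11,4,4]),
  ([U,I,I,T,I,U],[11,11,8,4,7]), ([U,I,I,T,I,I],[11,11,8,4,5]), ([I,U,I,U,U,I],[11,4,11,11,11]),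
  ([I,U,I,I,U,I],[11,4,11,11,11]), ([I,U,I,I,T,I],[8,4,7,11,11]), ([I,U,I,I,T,T],[11,4,11,11,11]),
  ([I,I,U,I,U,I],[11,9,11,4,6]), ([I,I,U,I,T,T],[11,11,11,11,4]), ([I,I,T,I,U,I],[4,7,11,11,8]),
  ([I,I,T,I,T,I],[4,5,11,11,8]), ([I,T,I,U,I,U],[11,8,4,7,11]), ([I,T,I,U,I,I],[11,8,4,7,11]),
  ([I,T,T,I,U,I],[11,11,4,11,11]), ([T,I,U,I,U,I],[5,11,11,8,4]), ([T,I,U,I,I,T],[7,11,11,8,4]),
  ([T,I,T,T,I,I],[4,11,11,11,11]), ([U,I,I,U,I,T],[11,11,11,11,5]), ([I,T,I,U,U,I],[11,11,5,11,9]),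
  ([T,I,I,U,U,U],[11,5,11,11,11]), ([T,I,I,I,U,I],[7,5,11,10,6]), ([U,I,U,I,I,I],[11,11,11,6,8]),
  ([U,I,I,I,U,I],[11,11,11,6,8]), ([U,I,T,I,U,I],[10,11,6,11,9]), ([U,I,T,I,I,T],[6,11,8,11,7]),
  ([I,I,I,U,I,T],[11,6,11,11,11]), ([I,T,I,U,I,T],[11,10,6,9,7]), ([T,I,U,I,U,U],[7,11,11,10,6]),
  ([T,I,U,I,I,U],[7,11,11,10,6]), ([T,I,U,I,I,I],[7,11,11,10,6]), ([T,I,U,I,T,I],[7,11,11,10,6]),
  ([T,I,T,I,I,T],[6,11,11,11,11]), ([U,I,U,U,U,I],[11,11,11,11,7]), ([U,I,T,T,I,I],[7,11,11,11,11]),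
  ([I,U,I,I,I,U],[11,7,11,11,11]), ([U,U,I,U,I,I],[11,8,9,11,11]), ([U,I,U,I,I,U],[11,11,11,8,11]),
  ([U,I,I,I,T,I],[11,8,11,8,8]), ([U,I,I,T,I,T],[11,11,11,8,9]), ([U,I,I,T,T,I],[11,11,11,9,8]),
  ([U,I,T,I,T,I],[10,10,11,11,8]), ([I,U,I,U,I,U],[11,8,11,11,11]), ([I,I,U,I,I,U],[11,11,11,8,11]),
  ([I,I,T,I,I,I],[8,11,11,11,11]), ([I,I,T,I,I,T],[8,11,11,11,11]), ([I,T,I,I,T,I],[11,11,8,9,11]),
  ([I,T,I,T,I,T],[11,11,8,11,11]), ([I,T,I,T,T,I],[11,11,8,11,11]), ([T,I,I,I,T,I],[11,8,11,10,11]),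
  ([T,I,T,I,U,I],[8,11,11,11,8]), ([T,I,T,I,T,I],[10,11,11,11,8]), ([T,T,I,U,I,I],[11,11,8,11,11]),
  ([U,I,U,U,I,I],[11,11,11,11,9]), ([U,I,I,U,U,I],[11,11,11,11,9]), ([U,I,I,U,I,I],[11,10,11,11,9]),
  ([I,U,U,I,U,I],[11,9,11,11,11]), ([I,U,U,I,T,I],[10,11,9,11,11]), ([I,U,I,I,I,I],[11,9,11,11,11]),
  ([I,U,I,T,T,T],[11,11,9,11,11]), ([I,I,U,U,I,I],[11,11,11,11,9]), ([I,T,T,I,I,T],[11,11,9,11,11]),
  ([T,I,I,T,I,I],[9,11,11,11,11]), ([T,I,T,T,I,U],[9,11,11,11,11]), ([U,U,I,T,I,I],[11,11,10,11,11]),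
  ([U,I,U,I,U,U],[11,11,11,10,11]), ([I,U,I,U,U,U],[11,10,11,11,11]), ([I,U,I,I,U,U],[11,10,11,11,11]),
  ([I,I,U,I,U,U],[11,11,11,10,11]), ([I,I,U,I,I,I],[11,11,11,10,11]), ([I,I,T,I,I,U],[10,11,11,11,11]),
  ([I,I,T,I,T,T],[10,11,11,11,11]), ([I,T,T,I,I,I],[11,11,10,11,11]), ([T,I,I,I,I,T],[11,11,11,11,10]),
  ([T,I,T,I,U,U],[11,11,11,11,10])]"

definition labelsC :: "(status list \<times> int list) list" where
  "labelsC =
  [([I,U,U,I,U,I],[11,0,11,11,11]), ([I,U,U,I,I,T],[11,0,11,11,11]), ([I,I,U,I,U,I],[11,0,11,11,11]),
  ([T,I,I,T,I,I],[0,11,11,11,11]), ([I,U,I,I,U,I],[10,1,11,11,11]), ([I,U,I,I,I,T],[9,2,11,11,11]),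
  ([I,I,U,I,I,T],[11,2,11,11,11]), ([U,I,T,I,T,I],[11,11,4,11,11]), ([I,U,U,I,I,I],[11,4,11,11,11]),
  ([I,U,I,I,I,U],[11,4,11,11,11]), ([I,I,U,I,I,U],[11,4,11,11,11]), ([I,T,T,I,U,I],[11,11,4,11,11]),
  ([I,T,T,I,T,I],[11,11,4,11,11]), ([I,U,U,I,I,U],[11,5,11,11,11]), ([I,T,I,I,T,I],[11,11,5,11,11]),
  ([U,I,U,I,T,I],[11,8,11,6,11]), ([U,I,T,I,U,I],[11,11,6,11,11]), ([U,I,T,I,I,U],[11,11,8,11,6]),
  ([I,U,U,I,U,U],[11,6,11,11,11]), ([I,U,U,I,T,I],[11,6,11,11,11]), ([I,U,I,I,I,I],[11,6,11,11,11]),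
  ([I,U,I,T,I,I],[11,6,11,11,8]), ([I,I,U,I,U,U],[11,6,11,11,11]), ([I,I,U,I,I,I],[11,6,11,11,11]),
  ([I,I,U,I,T,I],[11,8,11,6,11]), ([I,T,I,U,U,I],[11,11,6,11,11]), ([I,T,I,I,U,I],[8,11,6,11,11]),
  ([T,I,I,U,I,T],[6,11,11,8,11]), ([T,I,T,I,I,I],[11,11,8,11,6]), ([I,U,I,I,U,U],[11,7,11,11,11]),
  ([I,U,I,T,I,U],[11,7,11,11,9]), ([I,T,I,I,I,T],[9,11,7,11,11]), ([U,I,U,I,T,T],[11,10,11,8,11]),
  ([U,I,I,U,I,I],[11,11,11,8,11]), ([U,I,I,I,T,I],[11,11,11,8,11]), ([U,I,T,I,I,I],[11,11,10,11,8]),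
  ([U,I,T,I,I,T],[11,11,8,11,11]), ([I,U,I,U,I,T],[8,11,11,10,11]), ([I,U,I,T,I,T],[11,8,11,11,8]),
  ([I,T,I,U,I,T],[11,11,8,11,11]), ([I,T,I,I,U,U],[10,11,8,11,11]), ([I,T,I,T,I,I],[11,8,11,11,10]),
  ([T,I,I,U,I,U],[11,11,11,8,11]), ([T,I,I,U,I,I],[11,11,11,8,11]), ([T,I,T,I,I,U],[11,11,10,11,8]),
  ([U,I,U,I,I,I],[11,11,11,9,11]), ([I,T,T,I,I,T],[11,11,9,11,11]), ([U,U,I,I,T,I],[10,11,11,11,11]),
  ([U,I,U,U,I,I],[11,11,11,10,11]), ([U,I,I,U,I,U],[11,11,11,10,11]), ([U,I,I,T,I,U],[11,11,10,11,11]),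
  ([U,I,I,T,I,I],[11,11,10,11,11]), ([U,I,I,T,T,I],[11,11,11,10,11]), ([U,I,T,I,T,T],[11,11,10,11,11]),
  ([I,U,I,U,U,I],[10,11,11,11,11]), ([I,U,I,I,T,I],[10,11,11,11,11]), ([I,I,U,U,I,I],[11,11,11,10,11]),
  ([I,I,U,I,T,T],[11,11,11,10,11]), ([I,I,T,I,U,I],[11,11,11,11,10]), ([I,I,T,I,T,I],[11,11,11,11,10]),
  ([I,T,I,U,I,U],[11,10,11,11,11]), ([I,T,I,U,I,I],[11,10,11,11,11]), ([I,T,T,I,I,U],[11,11,10,11,11]),
  ([I,T,T,I,I,I],[11,11,10,11,11]), ([I,T,T,I,T,T],[11,11,10,11,11]), ([T,I,U,I,U,I],[11,11,11,10,11]),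
  ([T,I,U,I,I,T],[11,11,11,10,11]), ([T,I,I,I,T,I],[11,11,11,10,11]), ([T,I,T,T,I,U],[11,11,11,11,10])]"

lemma well_formed_potential: "well_formed 6 potential"
  by code_simp

lemma check_hubs: "check_hubs [labelsA, labelsB, labelsC] hubs"
  by code_simp

lemma check_potential: "check_potential potential (set hubs) potential []"
  by code_simp

text \<open>The table occurs both as the rows to check and as the map of targets: it contains every
  state that an affordable move leads to.\<close>

lemma check_labelsA: "check_labels potential labelsA labelsA"
  by code_simp

lemma check_labelsB: "check_labels potential labelsB labelsB"
  by code_simp

lemma check_labelsC: "check_labels potential labelsC labelsC"
  by code_simp

section \<open>Closed walks\<close>

text \<open>Moving the window by one trades \<open>g k\<close> for the equal
  \<open>g (k + n)\<close>.\<close>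

lemma sum_lessThan_periodic:
  fixes g :: "nat \<Rightarrow> 'a::ab_group_add"
  assumes "\<And>j. g (j + n) = g j"
  shows "(\<Sum>j<n. g (k + j)) = (\<Sum>j<n. g j)"
proof (induction k)
  case (Suc k)
  have "(\<Sum>j<n. g (Suc k + j)) + g k = (\<Sum>j<n. g (k + j)) + g (k + n)"
    using sum.lessThan_Suc_shift[of "\<lambda>j. g (k + j)" n] sum.lessThan_Suc[of "\<lambda>j. g (k + j)" n]
    by (simp add: add.commute)
  with Suc assms show ?case by simp
qed simp

lemma label_row:
  assumes "(s, us) \<in> set tab" "tab \<in> {labelsA, labelsB, labelsC}"
    and "(q, t) \<in> set (successors potential (lookup potential s + 50 - foldr min us 11) s)"
  shows "\<exists>ws. map_of tab q = Some ws \<and> dominates (t - (lookup potential s + 40)) us (rotate1 ws)"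
proof -
  have "check_labels potential tab tab"
    using assms(2) check_labelsA check_labelsB check_labelsC by blast
  then show ?thesis
    using check_moves_sound[OF check_labels_sound] assms(1,3) by blast
qed

text \<open>Around a closed walk the potential telescopes away, so the total price is
  \<open>40 * n\<close> plus the nonnegative reduced prices \<open>r\<close>. If these sum to at
  most 10, the tables are followed from a hub once around, and its own label forces
  \<open>5 dvd n\<close>.\<close>

lemma
  fixes s :: "nat \<Rightarrow> status list" and v :: "nat \<Rightarrow> label list"
  assumes len: "\<And>j. length (s j) = 6" "\<And>j. length (v j) = 7"
    and adm: "\<And>j. admissible (s j) (v (Suc j))"
    and step: "\<And>j. s (Suc j) = next_column False (s j) (v (Suc j))"
    and per: "\<And>j. s (j + n) = s j" "\<And>j. v (j + n) = v j"
  shows closed_walk_cost: "40 * int n \<le> (\<Sum>j<n. cost prices (v (Suc j)))"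
    and closed_walk_rigid:
      "3 \<le> n \<Longrightarrow> (\<Sum>j<n. cost prices (v (Suc j))) \<le> 40 * int n + 10 \<Longrightarrow> 5 dvd n"
proof -
  define d where "d j = lookup potential (s j)" for j
  define r where "r j = cost prices (v (Suc j)) + d (Suc j) - d j - 40" for j
  have succ: "(s (Suc j), r j + d j + 40) \<in> set (successors potential b (s j))"
    if "r j + d j + 40 \<le> b" for j b
    using successors_complete[OF well_formed_potential len(1) len(2) adm, of j b] that
    by (simp add: r_def d_def flip: step)
  \<comment> \<open>A smaller reduced price would place this step on a list that
    \<open>check_potential\<close> found empty.\<close>
  have r: "(if s j \<in> set hubs then 0 else 4) \<le> r j" for j
  proof (rule ccontr)
    assume "\<not> ?thesis"
    then have "r j + d j + 40 \<le> (if s j \<in> set hubs then d j + 39 else d j + 43)"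
      by auto
    then have "(s (Suc j), r j + d j + 40)
        \<in> set (successors potential (if s j \<in> set hubs then d j + 39 else d j + 43) (s j))"
      by (rule succ)
    moreover have "successors potential (if s j \<in> set hubs then d j + 39 else d j + 43) (s j) = []"
      using check_potential_sound[OF check_potential, of "s j"] well_formed_potential len(1)
      by (simp add: d_def split: if_splits)
    ultimately show False by simp
  qed
  then have r_nonneg: "0 \<le> r j" for j
    using order_trans[of 0 "if s j \<in> set hubs then 0 else 4" "r j"] by simp
  have "(\<Sum>j<n. r j) = (\<Sum>j<n. cost prices (v (Suc j))) + (\<Sum>j<n. d (Suc j) - d j) - 40 * int n"
    by (simp add: r_def sum.distrib sum_subtractf)
  also have "(\<Sum>j<n. d (Suc j) - d j) = 0"
    unfolding sum_lessThan_telescope using per(1)[of 0] by (simp add: d_def)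
  finally have sum_r: "(\<Sum>j<n. r j) = (\<Sum>j<n. cost prices (v (Suc j))) - 40 * int n"
    by simp
  show "40 * int n \<le> (\<Sum>j<n. cost prices (v (Suc j)))"
    using sum_nonneg[of "{..<n}" r] r_nonneg sum_r by simp
  assume n: "3 \<le> n" and le: "(\<Sum>j<n. cost prices (v (Suc j))) \<le> 40 * int n + 10"
  \<comment> \<open>Without a hub, three steps alone would cost 12.\<close>
  have "\<exists>k. s k \<in> set hubs"
  proof (rule ccontr)
    assume "\<not> ?thesis"
    then have "4 \<le> r j" for j
      using r[of j] by simp
    then have "(\<Sum>j<n. 4) \<le> (\<Sum>j<n. r j)"
      by (intro sum_mono)
    with n le sum_r show False by simp
  qed
  then obtain k where "s k \<in> set hubs" ..
  then obtain tab us where tab: "tab \<in> {labelsA, labelsB, labelsC}"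
      and us: "map_of tab (s k) = Some us" "us \<in> set unit_labels"
    using check_hubs_sound[OF check_hubs, of "s k"]
    unfolding starts_somewhere_iff list.set(1,2) by blast
  obtain p where p: "p < 5" "length us = 5" "us ! p = 0" "\<And>i. i < 5 \<Longrightarrow> us ! i \<le> 10 \<Longrightarrow> i = p"
    using unit_labels_nth[OF us(2)] by blast
  \<comment> \<open>\<open>C i\<close> is the reduced price spent in the first \<open>i\<close>
    steps from the hub. By periodicity a full round costs the same from any start, and as
    \<open>r\<close> is nonnegative all partial sums stay within the budget.\<close>
  define C where "C i = (\<Sum>j<i. r (k + j))" for i
  have "r (j + n) = r j" for j
    using per(1)[of j] per(1)[of "Suc j"] per(2)[of "Suc j"] by (simp add: r_def d_def)
  then have "C n = (\<Sum>j<n. r j)"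
    unfolding C_def by (rule sum_lessThan_periodic)
  moreover have "C i \<le> C n" if "i \<le> n" for i
    unfolding C_def by (rule sum_mono2) (use that r_nonneg in auto)
  ultimately have C: "C i \<le> 10" if "i \<le> n" for i
    using that[THEN \<open>\<And>i. i \<le> n \<Longrightarrow> C i \<le> C n\<close>] sum_r le by linarith
  \<comment> \<open>Invariant: the label of the current state, at the residue of the step number
    counted from \<open>p\<close>, is at most the price spent.\<close>
  have "\<exists>ws. map_of tab (s (k + i)) = Some ws \<and> length ws = 5 \<and> ws ! ((p + i) mod 5) \<le> C i"
    if "i \<le> n" for i
    using that
  proof (induction i)
    case 0
    then show ?case using us(1) p(1-3) by (simp add: C_def)
  next
    case (Suc i)
    then obtain ws where ws: "map_of tab (s (k + i)) = Some ws" "length ws = 5" "ws ! ((p + i) mod 5) \<le> C i"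
      by auto
    have C_Suc: "C (Suc i) = C i + r (k + i)"
      by (simp add: C_def)
    \<comment> \<open>The smallest label is at most \<open>C i\<close>, so the next step lies within
      the search bound of \<open>check_labels\<close>.\<close>
    have "foldr min ws 11 \<le> ws ! ((p + i) mod 5)"
      using ws(2) by (intro foldr_min_le nth_mem) simp
    then have "r (k + i) + d (k + i) + 40 \<le> d (k + i) + 50 - foldr min ws 11"
      using ws(3) C[OF Suc.prems] C_Suc by linarith
    then obtain ws' where ws': "map_of tab (s (Suc (k + i))) = Some ws'"
        "dominates (r (k + i)) ws (rotate1 ws')"
      using label_row[OF map_of_SomeD[OF ws(1)] tab, OF succ[unfolded d_def]] by (auto simp: d_def)
    have len': "length ws' = 5"
      using dominates_length[OF ws'(2)] ws(2) by simp
    have "rotate1 ws' ! ((p + i) mod 5) \<le> ws ! ((p + i) mod 5) + r (k + i)"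
      by (rule dominates_nth[OF ws'(2)]) (use ws C[OF Suc.prems] C_Suc in auto)
    \<comment> \<open>\<open>rotate1\<close> accounts for the step number growing by one modulo
      5.\<close>
    moreover have "rotate1 ws' ! ((p + i) mod 5) = ws' ! ((p + Suc i) mod 5)"
      using len' by (simp add: nth_rotate1 mod_Suc_eq)
    ultimately show ?case
      using ws'(1) len' ws(3) C_Suc by auto
  qed
  from this[of n] have "us ! ((p + n) mod 5) \<le> C n"
    using us(1) per(1)[of k] by simp
  then have "us ! ((p + n) mod 5) \<le> 10"
    using C[of n] by simp
  then have "(p + n) mod 5 = p"
    by (intro p(4)) simp_all
  then show "5 dvd n"
    using p(1) by presburger
qed

section \<open>The lower bound\<close>

text \<open>Unrolls the cycle into an infinite strip of period \<open>n\<close>, so that columns can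
  be read without wrapping around.\<close>

definition marking :: "(nat \<times> nat \<Rightarrow> nat) \<Rightarrow> nat \<Rightarrow> nat \<Rightarrow> nat \<Rightarrow> nat" where
  "marking f n i j = f (i, j mod n)"

lemma marking_periodic: "marking f n i (j + n) = marking f n i j"
  by (simp add: marking_def)

definition label :: "nat \<Rightarrow> label" where
  "label x = (if x = 0 then V0 else if x = 1 then V1 else V2)"

definition column :: "(nat \<times> nat \<Rightarrow> nat) \<Rightarrow> nat \<Rightarrow> nat \<Rightarrow> label list" where
  "column f n j = map (\<lambda>i. label (marking f n i j)) [0..<7]"

text \<open>The left neighbour of column \<open>j\<close> is column \<open>j + n - 1\<close>, which avoids truncated subtraction at \<open>j = 0\<close>.\<close>

definition status :: "(nat \<times> nat \<Rightarrow> nat) \<Rightarrow> nat \<Rightarrow> nat \<Rightarrow> nat \<Rightarrow> status" where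
  "status f n j i =
    (if marking f n i j = 2 then T
     else if marking f n i j = 1 \<or> (0 < i \<and> marking f n (i - 1) j = 2) \<or> marking f n (Suc i) j = 2 \<or>
       marking f n i (j + n - 1) = 2 then I
     else U)"

definition statuses :: "(nat \<times> nat \<Rightarrow> nat) \<Rightarrow> nat \<Rightarrow> nat \<Rightarrow> status list" where
  "statuses f n j = map (status f n j) [0..<6]"

lemma pverts_cylinder: "pverts (path_graph m \<box> cycle_graph n) = {0..<m} \<times> {0..<n}"
  by (simp add: cartesian_product_def path_graph_def cycle_graph_def)

lemma new_status_eq:
  "new_status up s v w =
    (if v = V2 then T else if v = V1 \<or> up \<or> s = T \<or> w = V2 then I else U)"
  by (cases v; cases up; cases s; cases w) simp_all

lemma is_two_iff: "is_two v \<longleftrightarrow> v = V2"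
  by (cases v) auto

context
  fixes f :: "nat \<times> nat \<Rightarrow> nat" and n :: nat
  assumes roman: "roman_dominating (path_graph 9 \<box> cycle_graph n) f" and n: "0 < n"
begin

lemma marking_le_2: "i < 9 \<Longrightarrow> marking f n i j = 0 \<or> marking f n i j = 1 \<or> marking f n i j = 2"
proof -
  assume "i < 9"
  then have "(i, j mod n) \<in> pverts (path_graph 9 \<box> cycle_graph n)"
    using n by (simp add: pverts_cylinder)
  then have "f (i, j mod n) \<in> {0, 1, 2}"
    using roman unfolding roman_dominating_def by blast
  then show ?thesis by (simp add: marking_def)
qed

lemma marking_dominated:
  assumes "i < 9" "marking f n i j = 0"
  shows "(0 < i \<and> marking f n (i - 1) j = 2) \<or> (Suc i < 9 \<and> marking f n (Suc i) j = 2) \<or>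
    marking f n i (Suc j) = 2 \<or> marking f n i (j + n - 1) = 2"
proof -
  have "(i, j mod n) \<in> pverts (path_graph 9 \<box> cycle_graph n)"
    using assms n by (simp add: pverts_cylinder)
  then obtain i' j' where w: "((i, j mod n), (i', j')) \<in> parcs (path_graph 9 \<box> cycle_graph n)"
      "f (i', j') = 2"
    using roman assms(2) unfolding roman_dominating_def marking_def by fastforce
  then consider "i' = i" "j' = Suc (j mod n) mod n" | "i' = i" "j mod n = Suc j' mod n" "j' < n"
    | "j' = j mod n" "i' = Suc i" "i' < 9" | "j' = j mod n" "i = Suc i'"
    by (auto simp: cartesian_product_def path_graph_def cycle_graph_def)
  then show ?thesis
  proof cases
    case 1
    then show ?thesis using w(2) by (simp add: marking_def mod_Suc_eq)
  next
    case 2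
    \<comment> \<open>Here the dominating vertex is the left neighbour: \<open>j'\<close> has to be
      recognised as the residue of \<open>j + n - 1\<close>.\<close>
    have "j + n - 1 = j + (n - 1)"
      using n by linarith
    then have "(j + n - 1) mod n = (j mod n + (n - 1)) mod n"
      by (simp only: mod_add_left_eq)
    also have "\<dots> = (Suc j' + (n - 1)) mod n"
      unfolding 2(2) by (simp only: mod_add_left_eq)
    also have "\<dots> = j'"
      using n 2(3) by simp
    finally show ?thesis using w(2) 2(1) by (simp add: marking_def)
  qed (use w(2) in \<open>auto simp: marking_def\<close>)
qed

lemma label_eq_V2: "i < 9 \<Longrightarrow> label (marking f n i j) = V2 \<longleftrightarrow> marking f n i j = 2"
  using marking_le_2[of i j] by (auto simp: label_def)

lemma label_eq_V1: "label (marking f n i j) = V1 \<longleftrightarrow> marking f n i j = 1"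
  by (auto simp: label_def)

lemma status_eq_T: "status f n j i = T \<longleftrightarrow> marking f n i j = 2"
  by (simp add: status_def)

text \<open>The left neighbour of column \<open>Suc j\<close> is column \<open>j + n\<close>, which
  equals column \<open>j\<close>; its entry is a 2 exactly if its status is
  \<open>T\<close>.\<close>

lemma status_Suc:
  assumes "i < 6"
  shows "new_status (0 < i \<and> is_two (label (marking f n (i - 1) (Suc j)))) (status f n j i)
    (label (marking f n i (Suc j))) (label (marking f n (Suc i) (Suc j))) = status f n (Suc j) i"
  using assms n unfolding new_status_eq status_eq_T is_two_iff
  by (auto simp: label_eq_V2 label_eq_V1 status_def marking_periodic)

lemma upt_6: "[0..<6] = [0, 1, 2, 3, 4, 5 :: nat]" and upt_7: "[0..<7] = [0, 1, 2, 3, 4, 5, 6 :: nat]"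
  by (simp_all add: upt_rec)

lemma statuses_Suc: "statuses f n (Suc j) = next_column False (statuses f n j) (column f n (Suc j))"
  using status_Suc[of 0 j] status_Suc[of 1 j] status_Suc[of 2 j] status_Suc[of 3 j] status_Suc[of 4 j]
    status_Suc[of 5 j]
  by (simp add: statuses_def column_def upt_6 upt_7 numeral_eq_Suc)

text \<open>A \<open>U\<close> cell is a 0 with no 2 above, below or on its left, so Roman
  domination puts a 2 on its right.\<close>

lemma not_blocked:
  assumes "i < 6"
  shows "\<not> blocked (status f n j i) (label (marking f n i (Suc j)))"
proof (cases "status f n j i")
  case U
  then have "marking f n i (Suc j) = 2"
    using marking_dominated[of i j] marking_le_2[of i j] assms by (auto simp: status_def split: if_splits)
  then show ?thesis
    using U by (simp add: label_def)
qed auto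

lemma admissible_statuses: "admissible (statuses f n j) (column f n (Suc j))"
  by (simp add: statuses_def column_def upt_6 upt_7 not_blocked)

lemma columns_periodic: "statuses f n (j + n) = statuses f n j" "column f n (j + n) = column f n j"
proof -
  have "marking f n i (j + n + n - 1) = marking f n i (j + n - 1)" for i
    using marking_periodic[of f n i "j + n - 1"] n by simp
  then show "statuses f n (j + n) = statuses f n j" "column f n (j + n) = column f n j"
    by (simp_all add: statuses_def status_def column_def marking_periodic cong: if_cong)
qed

lemma strip_cost:
  shows "40 * int n \<le> (\<Sum>j<n. cost prices (column f n j))"
    and "3 \<le> n \<Longrightarrow> (\<Sum>j<n. cost prices (column f n j)) \<le> 40 * int n + 10 \<Longrightarrow> 5 dvd n"
proof -
  have "length (statuses f n j) = 6" "length (column f n j) = 7" for j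
    by (simp_all add: statuses_def column_def)
  note walk = this admissible_statuses statuses_Suc columns_periodic
  \<comment> \<open>The walk pays for the column it enters, so its sum is shifted by one
    column.\<close>
  have "(\<Sum>j<n. cost prices (column f n (Suc j))) = (\<Sum>j<n. cost prices (column f n j))"
    using sum_lessThan_periodic[of "\<lambda>j. cost prices (column f n j)" n 1] columns_periodic(2) by simp
  then show "40 * int n \<le> (\<Sum>j<n. cost prices (column f n j))"
    "3 \<le> n \<Longrightarrow> (\<Sum>j<n. cost prices (column f n j)) \<le> 40 * int n + 10 \<Longrightarrow> 5 dvd n"
    using closed_walk_cost[of "statuses f n" "column f n" n, OF walk]
      closed_walk_rigid[of "statuses f n" "column f n" n, OF walk] by simp_all
qed

end

section \<open>Reflection of the cylinder and the sum over both halves\<close>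

definition mirror :: "(nat \<times> nat \<Rightarrow> nat) \<Rightarrow> nat \<times> nat \<Rightarrow> nat" where
  "mirror f = (\<lambda>(i, j). f (8 - i, j))"

lemma roman_dominating_mirror:
  assumes "roman_dominating (path_graph 9 \<box> cycle_graph n) f"
  shows "roman_dominating (path_graph 9 \<box> cycle_graph n) (mirror f)"
  unfolding roman_dominating_def
proof (intro conjI ballI impI)
  show "mirror f ` pverts (path_graph 9 \<box> cycle_graph n) \<subseteq> {0, 1, 2}"
    using assms unfolding roman_dominating_def pverts_cylinder mirror_def by (auto simp: image_subset_iff)
next
  fix v assume v: "v \<in> pverts (path_graph 9 \<box> cycle_graph n)" "mirror f v = 0"
  obtain i j where ij: "v = (i, j)" "i < 9" "j < n"
    using v(1) by (auto simp: pverts_cylinder)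
  then have "(8 - i, j) \<in> pverts (path_graph 9 \<box> cycle_graph n)" "f (8 - i, j) = 0"
    using v by (auto simp: pverts_cylinder mirror_def)
  then obtain i' j' where w: "((8 - i, j), (i', j')) \<in> parcs (path_graph 9 \<box> cycle_graph n)" "f (i', j') = 2"
    using assms unfolding roman_dominating_def by fastforce
  then have "((i, j), (8 - i', j')) \<in> parcs (path_graph 9 \<box> cycle_graph n)" "mirror f (8 - i', j') = 2"
      "(8 - i', j') \<in> pverts (path_graph 9 \<box> cycle_graph n)"
    using ij by (auto simp: cartesian_product_def path_graph_def cycle_graph_def mirror_def)
  then show "\<exists>w\<in>pverts (path_graph 9 \<box> cycle_graph n).
      v \<rightarrow>\<^bsub>with_proj (path_graph 9 \<box> cycle_graph n)\<^esub> w \<and> mirror f w = 2"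
    using ij by auto
qed

lemma price_label: "x \<in> {0, 1, 2} \<Longrightarrow> price (a, 2 * a) (label x) = a * int x"
  by (auto simp: label_def)

lemma price_38: "x \<in> {0, 1, 2} \<Longrightarrow> price (20, 38) (label x) + price (0, 2) (label x) = 20 * int x"
  by (auto simp: label_def)

text \<open>Row \<open>i\<close> is charged the prices of rows \<open>i\<close> and
  \<open>8 - i\<close>. For a 1 these are 20 + 0 in rows 0 to 2, 15 + 5 in row 3, 10 + 10 in row 4,
  and symmetrically; a 2 costs twice that, with 38 + 2 in rows 2 and 6.\<close>

lemma cost_mirror:
  assumes "roman_dominating (path_graph 9 \<box> cycle_graph n) f" "0 < n"
  shows "cost prices (column f n j) + cost prices (column (mirror f) n j) =
    20 * (\<Sum>i<9. int (marking f n i j))"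
proof -
  have "marking f n i j \<in> {0, 1, 2}" if "i < 9" for i
    using marking_le_2[OF assms that] by auto
  note p = price_label[OF this, of _ 20] price_label[OF this, of _ 15] price_label[OF this, of _ 10]
    price_label[OF this, of _ 5] price_38[OF this]
  have "marking (mirror f) n i j = marking f n (8 - i) j" for i
    by (simp add: marking_def mirror_def)
  then show ?thesis
    using p(1)[of 0] p(1)[of 1] p(5)[of 2] p(2)[of 3] p(4)[of 3] p(3)[of 4] p(2)[of 5] p(4)[of 5] p(5)[of 6]
      p(1)[of 7] p(1)[of 8]
    by (simp add: column_def upt_rec prices_def numeral_eq_Suc)
qed

lemma weight_cylinder:
  "int (weight (path_graph 9 \<box> cycle_graph n) f) = (\<Sum>j<n. \<Sum>i<9. int (marking f n i j))"
proof -
  have "weight (path_graph 9 \<box> cycle_graph n) f = (\<Sum>i<9. \<Sum>j<n. f (i, j))"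
    by (simp add: weight_def pverts_cylinder sum.cartesian_product atLeast0LessThan)
  also have "\<dots> = (\<Sum>j<n. \<Sum>i<9. f (i, j))"
    by (rule sum.swap)
  also have "\<dots> = (\<Sum>j<n. \<Sum>i<9. marking f n i j)"
    by (intro sum.cong) (auto simp: marking_def)
  finally show ?thesis by simp
qed

lemma weight_lower_bound:
  assumes roman: "roman_dominating (path_graph 9 \<box> cycle_graph n) f" and n: "3 \<le> n"
  shows "(if n mod 5 = 0 then 4 * n else 4 * n + 2) \<le> weight (path_graph 9 \<box> cycle_graph n) f"
proof -
  have "0 < n" using n by simp
  let ?c = "\<lambda>g. \<Sum>j<n. cost prices (column g n j)"
  have eq: "20 * int (weight (path_graph 9 \<box> cycle_graph n) f) = ?c f + ?c (mirror f)"
    by (simp only: weight_cylinder sum_distrib_left[of 20] cost_mirror[OF roman \<open>0 < n\<close>] flip: sum.distrib)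
  note top = strip_cost[OF roman \<open>0 < n\<close>]
  note bottom = strip_cost[OF roman_dominating_mirror[OF roman] \<open>0 < n\<close>]
  show ?thesis
  proof (cases "5 dvd n")
    case True
    then show ?thesis using eq top(1) bottom(1) by auto
  next
    case False
    then have "40 * int n + 10 < ?c f" "40 * int n + 10 < ?c (mirror f)"
      using top(2) bottom(2) n by force+
    \<comment> \<open>The sum exceeds \<open>80 * n + 20\<close>, so the weight exceeds
      \<open>4 * n + 1\<close>.\<close>
    then have "4 * n + 2 \<le> weight (path_graph 9 \<box> cycle_graph n) f"
      using eq by linarith
    then show ?thesis using False by (simp add: dvd_eq_mod_eq_0)
  qed
qed

section \<open>The upper bound\<close>

definition column_ok :: "nat list \<Rightarrow> nat list \<Rightarrow> nat list \<Rightarrow> bool" where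
  "column_ok x y z \<longleftrightarrow> length y = 9 \<and> (\<forall>i < 9. y ! i \<in> {0, 1, 2} \<and>
    (y ! i = 0 \<longrightarrow> x ! i = 2 \<or> z ! i = 2 \<or> (0 < i \<and> y ! (i - 1) = 2) \<or> (Suc i < 9 \<and> y ! Suc i = 2)))"

fun columns_ok :: "nat list list \<Rightarrow> bool" where
  "columns_ok (x # y # z # xs) \<longleftrightarrow> column_ok x y z \<and> columns_ok (y # z # xs)"
| "columns_ok _ \<longleftrightarrow> True"

definition cyclic_ok :: "nat list list \<Rightarrow> bool" where
  "cyclic_ok w \<longleftrightarrow> columns_ok (last w # w @ [hd w])"

text \<open>A window of three columns that meets \<open>xs\<close> ends at \<open>b\<close> at the
  latest; any other window starts at \<open>a\<close> or later.\<close>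

lemma columns_ok_append:
  "columns_ok (xs @ a # b # ys) \<longleftrightarrow> columns_ok (xs @ [a, b]) \<and> columns_ok (a # b # ys)"
proof (induction xs)
  case (Cons x xs)
  then show ?case
    by (cases xs rule: list.exhaust[case_product list.exhaust[of "tl xs"]]) (auto simp: neq_Nil_conv)
qed simp

text \<open>Cut at the seam: as first and last columns agree, the windows there are those that occur
  when each word is closed up on its own.\<close>

lemma cyclic_ok_append:
  assumes "cyclic_ok v" "cyclic_ok w" "v \<noteq> []" "w \<noteq> []" "hd v = hd w" "last v = last w"
  shows "cyclic_ok (v @ w)"
proof -
  have "butlast v @ [last w] = v"
    using assms(3,6) append_butlast_last_id[of v] by simp
  then have v: "butlast v @ last w # xs = v @ xs" for xs
    by (metis append_Cons append_Nil append_assoc)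
  have w: "hd w # tl w @ xs = w @ xs" for xs
    using assms(4) by (cases w) simp_all
  have "columns_ok (last w # v @ w @ [hd w])"
    using columns_ok_append[of "last w # butlast v" "last w" "hd w" "tl w @ [hd w]"] assms(1,2)
    by (simp add: v w cyclic_ok_def assms(5,6))
  then show ?thesis
    using assms(3-5) by (simp add: cyclic_ok_def)
qed

lemma columns_ok_nth:
  "columns_ok xs \<Longrightarrow> Suc (Suc i) < length xs \<Longrightarrow> column_ok (xs ! i) (xs ! Suc i) (xs ! Suc (Suc i))"
  by (induction xs arbitrary: i rule: columns_ok.induct) (auto simp: nth_Cons split: nat.splits)

lemma cyclic_ok_nth:
  assumes "cyclic_ok w" "j < length w"
  shows "column_ok (w ! ((j + length w - 1) mod length w)) (w ! j) (w ! (Suc j mod length w))"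
proof -
  let ?w = "last w # w @ [hd w]"
  have "w \<noteq> []" using assms(2) by auto
  have "column_ok (?w ! j) (?w ! Suc j) (?w ! Suc (Suc j))"
    using assms by (intro columns_ok_nth) (simp_all add: cyclic_ok_def)
  moreover have "?w ! Suc j = w ! j"
    using assms(2) by (simp add: nth_append)
  moreover have "?w ! Suc (Suc j) = w ! (Suc j mod length w)"
  proof (cases "Suc j = length w")
    case True
    then show ?thesis using \<open>w \<noteq> []\<close> by (simp add: hd_conv_nth nth_append)
  next
    case False
    then show ?thesis using assms(2) by (simp add: nth_append)
  qed
  moreover have "?w ! j = w ! ((j + length w - 1) mod length w)"
  proof (cases j)
    case 0
    then show ?thesis using \<open>w \<noteq> []\<close> by (simp add: last_conv_nth)
  next
    case (Suc k)
    then show ?thesis using assms(2) by (simp add: nth_append)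
  qed
  ultimately show ?thesis by simp
qed

text \<open>The word is read as a marking, its \<open>j\<close>-th letter being column
  \<open>j\<close>; \<open>column_ok\<close> for three cyclically consecutive columns is the Roman
  condition on the middle one.\<close>

lemma roman_domination_number_le:
  assumes ok: "cyclic_ok w" and w: "w \<noteq> []"
  shows "\<gamma>\<^sub>R (path_graph 9 \<box> cycle_graph (length w)) \<le> sum_list (map sum_list w)"
proof -
  define n where "n = length w"
  define G where "G = path_graph 9 \<box> cycle_graph n"
  define f where "f = (\<lambda>(i, j). w ! j ! i)"
  have col: "column_ok (w ! ((j + n - 1) mod n)) (w ! j) (w ! (Suc j mod n))" if "j < n" for j
    using cyclic_ok_nth[OF ok] that by (simp add: n_def)
  have "0 < n" using w by (simp add: n_def)
  have "roman_dominating G f"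
    unfolding roman_dominating_def
  proof (intro conjI ballI impI)
    show "f ` pverts G \<subseteq> {0, 1, 2}"
    proof (rule image_subsetI)
      fix v assume "v \<in> pverts G"
      then obtain i j where ij: "v = (i, j)" "i < 9" "j < n"
        by (auto simp: G_def pverts_cylinder)
      have "w ! j ! i \<in> {0, 1, 2}"
        using col[OF ij(3)] ij(2) unfolding column_ok_def by blast
      then show "f v \<in> {0, 1, 2}" by (simp add: f_def ij(1))
    qed
  next
    fix v assume v: "v \<in> pverts G" "f v = 0"
    obtain i j where ij: "v = (i, j)" "i < 9" "j < n"
      using v(1) by (auto simp: G_def pverts_cylinder)
    let ?l = "(j + n - 1) mod n" and ?r = "Suc j mod n"
    have lr: "?l < n" "?r < n"
      using \<open>0 < n\<close> by simp_all
    have "Suc ?l mod n = j"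
      using \<open>0 < n\<close> ij(3) by (simp add: mod_Suc_eq)
    then have arcs: "((i, j), (i, ?l)) \<in> parcs G" "((i, j), (i, ?r)) \<in> parcs G"
        "0 < i \<Longrightarrow> ((i, j), (i - 1, j)) \<in> parcs G" "Suc i < 9 \<Longrightarrow> ((i, j), (Suc i, j)) \<in> parcs G"
      using ij lr by (auto simp: G_def cartesian_product_def path_graph_def cycle_graph_def)
    have "w ! ?l ! i = 2 \<or> w ! ?r ! i = 2 \<or> (0 < i \<and> w ! j ! (i - 1) = 2) \<or> (Suc i < 9 \<and> w ! j ! Suc i = 2)"
      using col[OF ij(3)] ij(2) v(2) by (simp add: column_ok_def f_def ij(1))
    then obtain u where "((i, j), u) \<in> parcs G" "f u = 2"
      using arcs by (auto simp: f_def)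
    moreover from this have "u \<in> pverts G"
      by (cases u) (auto simp: G_def cartesian_product_def)
    ultimately show "\<exists>u\<in>pverts G. v \<rightarrow>\<^bsub>with_proj G\<^esub> u \<and> f u = 2"
      using ij(1) by auto
  qed
  moreover have "weight G f = sum_list (map sum_list w)"
  proof -
    have "(\<Sum>i<9. w ! j ! i) = sum_list (w ! j)" if "j < n" for j
      using col[OF that] by (simp add: column_ok_def sum_list_sum_nth atLeast0LessThan)
    then have "(\<Sum>j<n. \<Sum>i<9. f (i, j)) = (\<Sum>j<n. sum_list (w ! j))"
      by (simp add: f_def)
    also have "\<dots> = sum_list (map sum_list w)"
      by (simp add: sum_list_sum_nth n_def atLeast0LessThan)
    moreover have "weight G f = (\<Sum>i<9. \<Sum>j<n. f (i, j))"
      by (simp add: weight_def G_def pverts_cylinder sum.cartesian_product atLeast0LessThan)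
    ultimately show ?thesis
      by (simp add: sum.swap[of _ "{..<n}"])
  qed
  ultimately show ?thesis
    unfolding roman_domination_number_def G_def n_def by (intro Least_le) blast
qed

text \<open>
  \<open>base 0\<close> is the optimal pattern: 2s on the lattice \<open>i \<equiv> 3 j mod 5\<close>, and 1s in the boundary rows where the
  dominating lattice point would lie outside. The length of \<open>base r\<close> is \<open>r\<close> modulo 5 for \<open>r < 5\<close>.
\<close>

definition base :: "nat \<Rightarrow> nat list list" where
  "base r = [[2,0,0,0,0,2,0,0,0], [0,0,0,2,0,0,0,0,2]] @
    (if r = 0 then [[0,2,0,0,0,0,2,0,0], [1,0,0,0,2,0,0,0,1]]
     else if r = 1 then [[0,2,0,0,0,0,2,0,0], [0,2,0,0,2,0,0,0,1], [1,0,0,0,2,0,0,2,0]]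
     else if r = 2 then [[0,2,0,0,0,0,2,0,0], [0,0,0,0,2,0,0,0,2], [2,0,2,0,0,0,2,0,0], [0,1,0,0,2,0,0,0,1]]
     else if r = 3 then [[0,2,0,0,0,0,2,0,0], [0,0,0,0,2,0,0,1,0], [2,0,2,0,0,1,0,0,2], [0,0,0,1,0,0,2,0,0],
       [0,2,0,0,2,0,0,0,1]]
     else [[0,2,0,0,2,0,2,0,0]]) @
    [[0,0,2,0,0,0,0,2,0]]"

lemma all_less_9:
  "(\<forall>i < 9. P i) \<longleftrightarrow> P 0 \<and> P 1 \<and> P 2 \<and> P 3 \<and> P 4 \<and> P 5 \<and> P 6 \<and> P 7 \<and> P (8 :: nat)"
  by (auto simp: numeral_eq_Suc All_less_Suc)

lemma cyclic_ok_base: "cyclic_ok (base r)"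
  by (simp add: cyclic_ok_def base_def column_ok_def all_less_9)

text \<open>All words \<open>base r\<close> share their end columns with \<open>base 0\<close>, and
  each appended copy of \<open>base 0\<close> adds 5 columns of total weight 20.\<close>

lemma base_extension:
  "\<exists>w. cyclic_ok w \<and> length w = length (base r) + 5 * k \<and> w \<noteq> [] \<and> hd w = hd (base 0) \<and>
    last w = last (base 0) \<and> sum_list (map sum_list w) = sum_list (map sum_list (base r)) + 20 * k"
proof (induction k)
  case 0
  show ?case
    using cyclic_ok_base[of r] by (intro exI[of _ "base r"]) (simp add: base_def)
next
  case (Suc k)
  then obtain w where w: "cyclic_ok w" "length w = length (base r) + 5 * k" "w \<noteq> []" "hd w = hd (base 0)"
    "last w = last (base 0)" "sum_list (map sum_list w) = sum_list (map sum_list (base r)) + 20 * k"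
    by blast
  have "base 0 \<noteq> []" "length (base 0) = 5" "sum_list (map sum_list (base 0)) = 20"
    by (simp_all add: base_def)
  then show ?case
    using w cyclic_ok_append[OF w(1) cyclic_ok_base[of 0]] by (intro exI[of _ "w @ base 0"]) simp
qed

lemma roman_domination_number_upper_bound:
  assumes "3 \<le> n"
  shows "\<gamma>\<^sub>R (path_graph 9 \<box> cycle_graph n) \<le> (if n mod 5 = 0 then 4 * n else 4 * n + 2)"
proof (cases "n = 3")
  case True
  \<comment> \<open>The word \<open>base 3\<close> has length 8, so length 3 needs its own word, of
    weight 4 + 4 + 6 = 14.\<close>
  have "\<exists>w. cyclic_ok w \<and> length w = 3 \<and> w \<noteq> [] \<and> sum_list (map sum_list w) = 14"
    by (rule exI[of _ "[[0,1,0,1,0,1,0,1,0], [0,0,2,0,0,0,2,0,0], [2,0,0,0,2,0,0,0,2]]"])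
      (simp add: cyclic_ok_def column_ok_def all_less_9)
  then obtain w where "cyclic_ok w" "length w = 3" "w \<noteq> []" "sum_list (map sum_list w) = 14"
    by blast
  then show ?thesis
    using roman_domination_number_le[of w] True by simp
next
  case False
  define r where "r = n mod 5"
  have "r = 0 \<or> r = 1 \<or> r = 2 \<or> r = 3 \<or> r = 4"
    unfolding r_def by presburger
  then have base: "length (base r) = (if r = 4 then 4 else 5 + r)"
      "sum_list (map sum_list (base r)) = (if r = 0 then 4 * length (base r) else 4 * length (base r) + 2)"
    by (elim disjE; simp add: base_def)+
  \<comment> \<open>The lengths 4 to 8 represent every residue modulo 5, and each is the least
    \<open>n\<close> other than 3 in its class with \<open>n \<ge> 3\<close>.\<close>
  have "\<exists>k. n = (if r = 4 then 4 else 5 + r) + 5 * k"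
    using assms False unfolding r_def by presburger
  then obtain k where k: "n = length (base r) + 5 * k"
    unfolding base(1) ..
  obtain w where w: "cyclic_ok w" "length w = length (base r) + 5 * k" "w \<noteq> []"
      "sum_list (map sum_list w) = sum_list (map sum_list (base r)) + 20 * k"
    using base_extension[of r k] by blast
  have "length w = n" "sum_list (map sum_list w) = (if r = 0 then 4 * n else 4 * n + 2)"
    using w(2,4) k base(2) by simp_all
  then show ?thesis
    using roman_domination_number_le[OF w(1,3)] by (simp add: r_def)
qed

theorem mainTheorem3:
  fixes n :: nat
  assumes "n \<ge> 3"
  shows "\<gamma>\<^sub>R (path_graph 9 \<box> cycle_graph n) = (if n mod 5 = 0 then 4 * n else 4 * n + 2)"
proof (rule antisym)
  show "\<gamma>\<^sub>R (path_graph 9 \<box> cycle_graph n) \<le> (if n mod 5 = 0 then 4 * n else 4 * n + 2)"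
    using assms by (rule roman_domination_number_upper_bound)
  obtain f where "roman_dominating (path_graph 9 \<box> cycle_graph n) f"
      "weight (path_graph 9 \<box> cycle_graph n) f = \<gamma>\<^sub>R (path_graph 9 \<box> cycle_graph n)"
    using roman_domination_number_attained by blast
  with weight_lower_bound assms
  show "(if n mod 5 = 0 then 4 * n else 4 * n + 2) \<le> \<gamma>\<^sub>R (path_graph 9 \<box> cycle_graph n)"
    by metis
qed

end
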